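(* Let $k$ be a field of characteristic $p=2$. Let $r\ge1$ be an integer and let $\varrho:(\mathbb{Z}/p\mathbb{Z})^r\to GL(4,k)$ be a (modular) representation. Then $\varrho$ is equivalent to a representation $\varrho':(\mathbb{Z}/p\mathbb{Z})^r\to GL(4,k)$ such that the matrices $\varrho'(e_i)$ $(1\le i\le r)$ have (simultaneously for all $i$) one of the following forms (1), (2), (3), (4), with $\alpha_i,\beta_i,\gamma_i,\delta_i\in k$: (1) $\begin{pmatrix}1&\alpha_i&\beta_i&\gamma_i\\0&1&0&0\\0&0&1&0\\0&0&0&1\end{pmatrix}$ $(1\le i\le r)$. (2) $\begin{pmatrix}1&0&\alpha_i&\beta_i\\0&1&\gamma_i&\delta_i\\0&0&1&0\\0&0&0&1\end{pmatrix}$ $(1\le i\le r)$. (3) $\begin{pmatrix}1&0&0&\alpha_i\\0&1&0&\beta_i\\0&0&1&\gamma_i\\0&0&0&1\end{pmatrix}$ $(1\le i\le r)$. (4) $\begin{pmatrix}1&\alpha_i&\beta_i&\gamma_i\\0&1&0&\mu\beta_i\\0&0&1&\mu\alpha_i\\0&0&0&1\end{pmatrix}$ $(1\le i\le r)$, having a constant $\mu\in k$ (independent of $i$) with $\mu\ne0$.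
   Context: $e_1,\dots,e_r$ are the standard generators of $(\mathbb{Z}/p\mathbb{Z})^r$ ($e_i$ has $i$-th entry $[1]$ and other entries $[0]$). Representations $\varrho,\varrho'$ into $GL(4,k)$ are equivalent if there is $P\in GL(4,k)$ with $P^{-1}\varrho(g)P=\varrho'(g)$ for all $g$. (Every representation of $(\mathbb{Z}/p\mathbb{Z})^r$, $r\ge1$, over a field of characteristic $p$ is modular, i.e. $p$ divides the group order.) *)

theory Defs
  imports "HOL-Analysis.Analysis" "HOL-Algebra.Elementary_Groups" "HOL-Algebra.Product_Groups"
begin

definition elem_ab_group :: "nat \<Rightarrow> nat \<Rightarrow> (nat \<Rightarrow> int) monoid"
  where "elem_ab_group p r = product_group {1..r} (\<lambda>_. integer_mod_group p)"

text \<open>The standard generator; for \<open>p \<ge> 2\<close> the class of 1 is represented by 1.\<close>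

definition std_gen :: "nat \<Rightarrow> nat \<Rightarrow> (nat \<Rightarrow> int)"
  where "std_gen r i = (\<lambda>j\<in>{1..r}. if j = i then 1 else 0)"

definition GL_group :: "('k::field ^ 'n ^ 'n) monoid"
  where "GL_group = \<lparr>carrier = {A. invertible A}, monoid.mult = (**), one = mat 1\<rparr>"

definition is_representation :: "('g, 'm) monoid_scheme \<Rightarrow> ('g \<Rightarrow> 'k::field ^ 'n ^ 'n) \<Rightarrow> bool"
  where "is_representation G \<rho> \<longleftrightarrow> \<rho> \<in> hom G GL_group"

definition equivalent_representations ::
    "('g, 'm) monoid_scheme \<Rightarrow> ('g \<Rightarrow> 'k::field ^ 'n ^ 'n) \<Rightarrow> ('g \<Rightarrow> 'k ^ 'n ^ 'n) \<Rightarrow> bool"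
  where "equivalent_representations G \<rho> \<rho>' \<longleftrightarrow>
    (\<exists>P. invertible P \<and> (\<forall>g\<in>carrier G. matrix_inv P ** \<rho> g ** P = \<rho>' g))"

text \<open>Matrices are lists of rows.\<close>

definition form1 :: "'k::field \<Rightarrow> 'k \<Rightarrow> 'k \<Rightarrow> 'k ^ 4 ^ 4"
  where "form1 \<alpha> \<beta> \<gamma> = vector
    [vector [1, \<alpha>, \<beta>, \<gamma>],
     vector [0, 1, 0, 0],
     vector [0, 0, 1, 0],
     vector [0, 0, 0, 1]]"

definition form2 :: "'k::field \<Rightarrow> 'k \<Rightarrow> 'k \<Rightarrow> 'k \<Rightarrow> 'k ^ 4 ^ 4"
  where "form2 \<alpha> \<beta> \<gamma> \<delta> = vector
    [vector [1, 0, \<alpha>, \<beta>],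
     vector [0, 1, \<gamma>, \<delta>],
     vector [0, 0, 1, 0],
     vector [0, 0, 0, 1]]"

definition form3 :: "'k::field \<Rightarrow> 'k \<Rightarrow> 'k \<Rightarrow> 'k ^ 4 ^ 4"
  where "form3 \<alpha> \<beta> \<gamma> = vector
    [vector [1, 0, 0, \<alpha>],
     vector [0, 1, 0, \<beta>],
     vector [0, 0, 1, \<gamma>],
     vector [0, 0, 0, 1]]"

definition form4 :: "'k::field \<Rightarrow> 'k \<Rightarrow> 'k \<Rightarrow> 'k \<Rightarrow> 'k ^ 4 ^ 4"
  where "form4 \<mu> \<alpha> \<beta> \<gamma> = vector
    [vector [1, \<alpha>, \<beta>, \<gamma>],
     vector [0, 1, 0, \<mu> * \<beta>],
     vector [0, 0, 1, \<mu> * \<alpha>],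
     vector [0, 0, 0, 1]]"

lemma group_elem_ab_group: "group (elem_ab_group p r)"
  unfolding elem_ab_group_def by (rule product_group) (simp add: group_integer_mod_group)

lemma std_gen_in_carrier: "p \<ge> 2 \<Longrightarrow> std_gen r i \<in> carrier (elem_ab_group p r)"
  by (auto simp: elem_ab_group_def std_gen_def carrier_integer_mod_group)

lemma group_GL_group: "group (GL_group :: ('k::field ^ 'n ^ 'n) monoid)"
proof (rule groupI)
  fix A :: "'k ^ 'n ^ 'n" assume "A \<in> carrier GL_group"
  then show "\<exists>B\<in>carrier GL_group. B \<otimes>\<^bsub>GL_group\<^esub> A = \<one>\<^bsub>GL_group\<^esub>"
    unfolding GL_group_def invertible_def by auto
qed (auto simp: GL_group_def invertible_mult matrix_mul_assoc invertible_def[of "mat 1"])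

end

theory Submission
  imports Defs
begin

text \<open>
  In characteristic 2 the matrices \<open>N i = \<rho> (e i) - 1\<close> commute and square to zero. Suppose first that
  all products \<open>N i N j\<close> vanish. Then the sum \<open>I\<close> of the images lies in the intersection \<open>K\<close> of
  the kernels, and there is a subspace \<open>I \<subseteq> U \<subseteq> K\<close> of dimension 1, 2 or 3; a basis of the whole
  space that starts with a basis of \<open>U\<close> gives form (1), (2) or (3) respectively. Otherwise
  \<open>N m N n v \<noteq> 0\<close> for some \<open>m\<close>, \<open>n\<close>, \<open>v\<close>, and \<open>N m N n v, N m v, N n v, v\<close> is a basis: the space
  is free of rank one over \<open>k[x, y] / (x\<^sup>2, y\<^sup>2)\<close>. Every \<open>N i\<close> commutes with \<open>N m\<close> and \<open>N n\<close>, so it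
  is determined by \<open>N i v\<close>, which yields form (4) with \<open>\<mu> = 1\<close>.
\<close>

section \<open>Matrices with prescribed columns and change of basis\<close>

text \<open>\<open>vector\<close> lists rows, hence the transposition: for a basis the result is the
  change-of-basis matrix \<open>P\<close> of the equivalence.\<close>

definition cols4 :: "'k::field ^ 4 \<Rightarrow> 'k ^ 4 \<Rightarrow> 'k ^ 4 \<Rightarrow> 'k ^ 4 \<Rightarrow> 'k ^ 4 ^ 4"
  where "cols4 a b c d = transpose (vector [a, b, c, d])"

lemma vector4_nth [simp]:
  "(vector [a, b, c, d] :: 'a::zero ^ 4) $ 1 = a"
  "(vector [a, b, c, d] :: 'a::zero ^ 4) $ 2 = b"
  "(vector [a, b, c, d] :: 'a::zero ^ 4) $ 3 = c"
  "(vector [a, b, c, d] :: 'a::zero ^ 4) $ 4 = d"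
  by (simp_all add: vector_def)

lemma column_cols4 [simp]:
  "column 1 (cols4 a b c d) = a" "column 2 (cols4 a b c d) = b"
  "column 3 (cols4 a b c d) = c" "column 4 (cols4 a b c d) = d"
  by (simp_all add: cols4_def row_def)

lemma UNIV_num4: "(UNIV :: 4 set) = {1, 2, 3, 4}"
  using exhaust_4 by auto

lemma cols4_mult_vec: "cols4 a b c d *v x = x $ 1 *s a + x $ 2 *s b + x $ 3 *s c + x $ 4 *s d"
  by (simp add: matrix_mult_sum sum_4)

lemma invertible_cols4_span:
  assumes "vec.span {a, b, c, d} = (UNIV :: ('k::field ^ 4) set)"
  shows "invertible (cols4 a b c d)"
proof -
  have "columns (cols4 a b c d) = {a, b, c, d}"
    unfolding columns_def Setcompr_eq_image UNIV_num4 by simp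
  then show ?thesis
    using assms by (metis invertible_right_inverse matrix_right_invertible_span_columns)
qed

lemma invertible_cols4_independent:
  fixes a b c d :: "'k::field ^ 4"
  assumes "\<And>w x y z. w *s a + x *s b + y *s c + z *s d = 0 \<Longrightarrow> w = 0 \<and> x = 0 \<and> y = 0 \<and> z = 0"
  shows "invertible (cols4 a b c d)"
  unfolding invertible_left_inverse matrix_left_invertible_independent_columns
  using assms by (auto simp: sum_4 forall_4)

lemma invertible_cols4_expand:
  assumes "invertible (cols4 a b c d)"
  obtains w x y z where "v = w *s a + x *s b + y *s c + z *s d"
proof -
  obtain Q where "cols4 a b c d ** Q = mat 1"
    using assms by (auto simp: invertible_def)
  then have "v = cols4 a b c d *v (Q *v v)"
    by (simp add: matrix_vector_mul_assoc)
  then show thesis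
    unfolding cols4_mult_vec by (rule that)
qed

lemma matrix_inv_cancel:
  fixes A :: "'k::field ^ 'n ^ 'n"
  assumes "invertible A"
  shows matrix_mult_inv_right: "A ** matrix_inv A = mat 1"
    and matrix_mult_inv_left: "matrix_inv A ** A = mat 1"
  using assms someI_ex[of "\<lambda>B. A ** B = mat 1 \<and> B ** A = mat 1"]
  by (auto simp: invertible_def matrix_inv_def)

text \<open>The identity to reach is \<open>A ** P = P ** M\<close>, which can be compared column by
  column: on the left stand the images of the basis vectors under \<open>A\<close>, on the right
  their expansions with coefficients from \<open>M\<close>. No inverse has to be computed.\<close>

lemma conj_cols4_eqI:
  fixes A M :: "'k::field ^ 4 ^ 4" and a b c d :: "'k ^ 4"
  defines "P \<equiv> cols4 a b c d"
  assumes "invertible P"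
    and "A *v a = P *v column 1 M" "A *v b = P *v column 2 M"
    and "A *v c = P *v column 3 M" "A *v d = P *v column 4 M"
  shows "matrix_inv P ** A ** P = M"
proof -
  have "column j (A ** P) = A *v column j P" for j
    by (simp add: vec_eq_iff column_def matrix_matrix_mult_def matrix_vector_mult_def)
  moreover have "column j (P ** M) = P *v column j M" for j
    by (simp add: vec_eq_iff column_def matrix_matrix_mult_def matrix_vector_mult_def)
  ultimately have "\<forall>j. column j (A ** P) = column j (P ** M)"
    using assms by (simp add: forall_4)
  then have "A ** P = P ** M"
    by (simp add: vec_eq_iff column_def)
  then show ?thesis
    using matrix_mult_inv_left[OF \<open>invertible P\<close>]
    by (metis matrix_mul_assoc matrix_mul_lid)
qed

text \<open>Each image is written as the basis vector plus a correction, so that for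
  \<open>A = mat 1 + N\<close> the corrections are the values of \<open>N\<close>.\<close>

lemma conj_cols4_forms:
  fixes A :: "'k::field ^ 4 ^ 4"
  assumes inv: "invertible (cols4 a b c d)"
  shows conj_form1: "A *v a = a \<Longrightarrow> A *v b = b + x *s a \<Longrightarrow> A *v c = c + y *s a \<Longrightarrow> A *v d = d + z *s a
      \<Longrightarrow> matrix_inv (cols4 a b c d) ** A ** cols4 a b c d = form1 x y z"
    and conj_form2: "A *v a = a \<Longrightarrow> A *v b = b \<Longrightarrow> A *v c = c + (x *s a + z *s b) \<Longrightarrow> A *v d = d + (y *s a + w *s b)
      \<Longrightarrow> matrix_inv (cols4 a b c d) ** A ** cols4 a b c d = form2 x y z w"
    and conj_form3: "A *v a = a \<Longrightarrow> A *v b = b \<Longrightarrow> A *v c = c \<Longrightarrow> A *v d = d + (x *s a + y *s b + z *s c)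
      \<Longrightarrow> matrix_inv (cols4 a b c d) ** A ** cols4 a b c d = form3 x y z"
    and conj_form4: "A *v a = a \<Longrightarrow> A *v b = b + x *s a \<Longrightarrow> A *v c = c + y *s a
      \<Longrightarrow> A *v d = d + (z *s a + (m * y) *s b + (m * x) *s c)
      \<Longrightarrow> matrix_inv (cols4 a b c d) ** A ** cols4 a b c d = form4 m x y z"
  by (rule conj_cols4_eqI[OF inv];
      simp add: cols4_mult_vec column_def form1_def form2_def form3_def form4_def; fail)+

section \<open>Simultaneous normal forms\<close>

text \<open>The parameters are functions of the index, whereas \<open>\<mu>\<close> is chosen before
  \<open>i\<close> and is therefore common to the whole family.\<close>

definition simultaneous_form :: "'i set \<Rightarrow> ('i \<Rightarrow> 'k::field ^ 4 ^ 4) \<Rightarrow> bool"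
  where "simultaneous_form S M \<longleftrightarrow>
    (\<exists>\<alpha> \<beta> \<gamma>. \<forall>i\<in>S. M i = form1 (\<alpha> i) (\<beta> i) (\<gamma> i)) \<or>
    (\<exists>\<alpha> \<beta> \<gamma> \<delta>. \<forall>i\<in>S. M i = form2 (\<alpha> i) (\<beta> i) (\<gamma> i) (\<delta> i)) \<or>
    (\<exists>\<alpha> \<beta> \<gamma>. \<forall>i\<in>S. M i = form3 (\<alpha> i) (\<beta> i) (\<gamma> i)) \<or>
    (\<exists>\<mu> \<alpha> \<beta> \<gamma>. \<mu> \<noteq> 0 \<and> (\<forall>i\<in>S. M i = form4 \<mu> (\<alpha> i) (\<beta> i) (\<gamma> i)))"

lemma simultaneous_formI:
  shows simultaneous_form1: "(\<And>i. i \<in> S \<Longrightarrow> M i = form1 (\<alpha> i) (\<beta> i) (\<gamma> i)) \<Longrightarrow> simultaneous_form S M"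
    and simultaneous_form2: "(\<And>i. i \<in> S \<Longrightarrow> M i = form2 (\<alpha> i) (\<beta> i) (\<gamma> i) (\<delta> i)) \<Longrightarrow> simultaneous_form S M"
    and simultaneous_form3: "(\<And>i. i \<in> S \<Longrightarrow> M i = form3 (\<alpha> i) (\<beta> i) (\<gamma> i)) \<Longrightarrow> simultaneous_form S M"
    and simultaneous_form4: "\<mu> \<noteq> 0 \<Longrightarrow> (\<And>i. i \<in> S \<Longrightarrow> M i = form4 \<mu> (\<alpha> i) (\<beta> i) (\<gamma> i)) \<Longrightarrow> simultaneous_form S M"
  unfolding simultaneous_form_def
  subgoal by (rule disjI1) (intro exI ballI)
  subgoal by (rule disjI2, rule disjI1) (intro exI ballI)
  subgoal by (rule disjI2, rule disjI2, rule disjI1) (intro exI ballI)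
  subgoal by (rule disjI2, rule disjI2, rule disjI2) (intro exI conjI ballI)
  done

section \<open>A basis adapted to the images and kernels\<close>

text \<open>A basis \<open>BI\<close> of \<open>I\<close> is extended to a basis \<open>C\<close> of
  \<open>K\<close> and then to a basis \<open>D\<close> of the whole space. Any \<open>B\<close>
  between \<open>BI\<close> and \<open>C\<close> spans a subspace between \<open>I\<close> and
  \<open>K\<close>; only its size has to be chosen.\<close>

lemma adapted_basis:
  fixes I K :: "('k::field ^ 'n) set"
  assumes sub: "vec.subspace I" "vec.subspace K" and "I \<subseteq> K" "I \<noteq> UNIV" "K \<noteq> {0}"
    and "CARD('n) \<ge> 2"
  obtains B D where "B \<subseteq> D" "card D = CARD('n)" "vec.span D = UNIV" "0 < card B" "card B < CARD('n)"
    "I \<subseteq> vec.span B" "B \<subseteq> K"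
proof -
  obtain BI where BI: "BI \<subseteq> I" "vec.independent BI" "I \<subseteq> vec.span BI"
    by (rule vec.maximal_independent_subset)
  obtain C where C: "BI \<subseteq> C" "C \<subseteq> K" "vec.independent C" "K \<subseteq> vec.span C"
    using BI \<open>I \<subseteq> K\<close> by (meson order.trans vec.maximal_independent_subset_extend)
  obtain D where D: "C \<subseteq> D" "vec.independent D" "UNIV \<subseteq> vec.span D"
    using C by (meson subset_UNIV vec.maximal_independent_subset_extend)
  have fin: "finite D" "finite C" "finite BI"
    using D C BI vec.finiteI_independent by blast+
  have cardD: "card D = CARD('n)"
    using D vec.dim_eq_card_independent vec.dim_span
    by (metis card_cart_basis independent_cart_basis span_cart_basis top.extremum_uniqueI)
  have "card BI \<noteq> CARD('n)"
  proof
    assume "card BI = CARD('n)"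
    then have "BI = D" using cardD C D fin by (metis card_subset_eq order.trans)
    then have "I = UNIV" using D BI sub by (metis top.extremum_uniqueI vec.span_minimal)
    then show False using \<open>I \<noteq> UNIV\<close> by simp
  qed
  moreover have "card BI \<le> CARD('n)"
    using cardD C D fin by (metis card_mono order.trans)
  ultimately have lt: "card BI < CARD('n)" by simp
  have "C \<noteq> {}"
    using C \<open>K \<noteq> {0}\<close> sub vec.subspace_0 by fastforce
  then have pos: "0 < card C" using fin by (simp add: card_gt_0_iff)
  \<comment> \<open>The maximum with 1 matters when \<open>I\<close> is zero. This size is at most
    \<open>card C\<close> because \<open>C\<close> is nonempty, and below \<open>CARD('n)\<close>
    because \<open>card BI\<close> is and the dimension is at least 2.\<close>
  obtain B where "BI \<subseteq> B" "B \<subseteq> C" "card B = max 1 (card BI)"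
    using exists_subset_between[of BI "max 1 (card BI)" C] pos fin C(1)
    by (auto simp: card_mono)
  moreover have "I \<subseteq> vec.span B"
    using BI(3) \<open>BI \<subseteq> B\<close> vec.span_mono by blast
  ultimately show thesis
    using C D cardD \<open>CARD('n) \<ge> 2\<close> lt by (intro that[of B D]) auto
qed

section \<open>The case of vanishing products\<close>

text \<open>Every \<open>N i\<close> maps into the span of \<open>B\<close> and vanishes on
  \<open>B\<close>. In the basis \<open>D\<close> with \<open>B\<close> first, only the upper right
  block of \<open>card B\<close> rows can be nonzero, and the sizes 1, 2, 3 give the first three
  forms.\<close>

lemma normal_form_products_zero:
  fixes N :: "'i \<Rightarrow> 'k::field ^ 4 ^ 4"
  assumes NN: "\<And>i j x. i \<in> S \<Longrightarrow> j \<in> S \<Longrightarrow> N i *v (N j *v x) = 0"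
  obtains P where "invertible P" "simultaneous_form S (\<lambda>i. matrix_inv P ** (mat 1 + N i) ** P)"
proof -
  define K where "K = {x. \<forall>i\<in>S. N i *v x = 0}"
  define I where "I = vec.span (\<Union>i\<in>S. range ((*v) (N i)))"
  have K: "vec.subspace K"
    by (simp add: K_def vec.subspace_def matrix_vector_right_distrib vec.scale)
  have I: "vec.subspace I"
    by (simp add: I_def)
  have NI: "N i *v x \<in> I" if "i \<in> S" for i x
    using that by (auto simp: I_def intro: vec.span_base)
  have IK: "I \<subseteq> K"
    unfolding I_def by (rule vec.span_minimal[OF _ K]) (use NN in \<open>auto simp: K_def\<close>)
  have K0: "K \<noteq> {0}"
  proof
    assume "K = {0}"
    \<comment> \<open>Here \<open>1\<close> is the vector with all entries 1, used as a concrete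
      nonzero vector. Its images lie in \<open>I\<close>, hence in \<open>K\<close>, which is zero
      by assumption.\<close>
    then have "N i *v 1 = 0" if "i \<in> S" for i
      using NI[OF that] IK by blast
    then have "1 \<in> K" by (simp add: K_def)
    then show False using \<open>K = {0}\<close> by simp
  qed
  \<comment> \<open>If \<open>I\<close> were everything, so would be \<open>K\<close>; then all
    \<open>N i\<close> vanish and \<open>I\<close> is zero, which excludes the nonzero vector
    \<open>1\<close>.\<close>
  have "1 \<notin> I" if "I = UNIV"
  proof -
    have "(\<Union>i\<in>S. range ((*v) (N i))) \<subseteq> {0}"
      using IK that by (auto simp: K_def)
    then have "I \<subseteq> {0}"
      unfolding I_def by (metis vec.span_minimal vec.subspace_single_0)
    then show ?thesis by auto
  qed
  then have IU: "I \<noteq> UNIV" by auto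
  obtain B D where BD: "B \<subseteq> D" "card D = 4" "vec.span D = UNIV" "0 < card B" "card B < 4"
    "I \<subseteq> vec.span B" "B \<subseteq> K"
    using adapted_basis[OF I K IK IU K0] by auto
  have fin: "finite D" "finite B" using BD by (auto intro: card_ge_0_finite)
  have cDB: "card (D - B) = 4 - card B" using BD fin by (simp add: card_Diff_subset)
  have NB: "N i *v x = 0" if "i \<in> S" "x \<in> B" for i x
    using BD that by (auto simp: K_def)
  have inB: "N i *v x \<in> vec.span B" if "i \<in> S" for i x
    using BD NI that by blast
  consider "card B = 1" | "card B = 2" | "card B = 3" using BD by linarith
  then show thesis
  proof cases
    case 1
    then obtain a where a: "B = {a}" by (rule card_1_singletonE)
    obtain b c d where "D - B = {b, c, d}" using cDB 1 by (auto simp: card_3_iff)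
    then have "D = {a, b, c, d}" using a BD by auto
    then have inv: "invertible (cols4 a b c d)" using BD invertible_cols4_span by metis
    have "\<exists>k. N i *v x = k *s a" if "i \<in> S" for i x
      using inB[OF that, of x] by (auto simp: a vec.span_singleton)
    then obtain f where f: "\<And>i x. i \<in> S \<Longrightarrow> N i *v x = f i x *s a" by metis
    have "matrix_inv (cols4 a b c d) ** (mat 1 + N i) ** cols4 a b c d = form1 (f i b) (f i c) (f i d)"
      if "i \<in> S" for i
      using NB[OF that] f[OF that, of b] f[OF that, of c] f[OF that, of d]
      by (intro conj_form1[OF inv]) (simp_all add: a matrix_vector_mult_add_rdistrib)
    then show thesis by (rule that[OF inv simultaneous_form1])
  next
    case 2
    then obtain a b where ab: "B = {a, b}" by (auto simp: card_2_iff)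
    obtain c d where "D - B = {c, d}" using cDB 2 by (auto simp: card_2_iff)
    then have "D = {a, b, c, d}" using ab BD by auto
    then have inv: "invertible (cols4 a b c d)" using BD invertible_cols4_span by metis
    have "\<exists>k l. N i *v x = k *s a + l *s b" if "i \<in> S" for i x
      using inB[OF that, of x]
      by (simp add: ab vec.span_breakdown_eq vec.span_singleton image_iff algebra_simps)
    then obtain f g where fg: "\<And>i x. i \<in> S \<Longrightarrow> N i *v x = f i x *s a + g i x *s b" by metis
    have "matrix_inv (cols4 a b c d) ** (mat 1 + N i) ** cols4 a b c d
        = form2 (f i c) (f i d) (g i c) (g i d)" if "i \<in> S" for i
      using NB[OF that] fg[OF that, of c] fg[OF that, of d]
      by (intro conj_form2[OF inv]) (simp_all add: ab matrix_vector_mult_add_rdistrib)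
    then show thesis by (rule that[OF inv simultaneous_form2])
  next
    case 3
    then obtain a b c where abc: "B = {a, b, c}" by (auto simp: card_3_iff)
    obtain d where "D - B = {d}" using cDB 3 by (auto simp: card_1_singleton_iff)
    then have "D = {a, b, c, d}" using abc BD by auto
    then have inv: "invertible (cols4 a b c d)" using BD invertible_cols4_span by metis
    have "\<exists>k l m. N i *v x = k *s a + l *s b + m *s c" if "i \<in> S" for i x
      using inB[OF that, of x]
      by (simp add: abc vec.span_breakdown_eq vec.span_singleton image_iff algebra_simps; metis)
    then obtain f g h where fgh: "\<And>i x. i \<in> S \<Longrightarrow> N i *v x = f i x *s a + g i x *s b + h i x *s c"
      by metis
    have "matrix_inv (cols4 a b c d) ** (mat 1 + N i) ** cols4 a b c d
        = form3 (f i d) (g i d) (h i d)" if "i \<in> S" for i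
      using NB[OF that] fgh[OF that, of d]
      by (intro conj_form3[OF inv]) (simp_all add: abc matrix_vector_mult_add_rdistrib)
    then show thesis by (rule that[OF inv simultaneous_form3])
  qed
qed

section \<open>The case of a nonvanishing product\<close>

text \<open>Since \<open>v\<close> generates the space under \<open>N m\<close> and
  \<open>N n\<close>, commutation transports the expansion of \<open>N i *v v\<close> to the other
  basis vectors. The maps \<open>N m\<close> and \<open>N n\<close> send \<open>c\<close> and
  \<open>b\<close>, respectively, to \<open>a\<close>, so the coefficients of \<open>c\<close> and
  \<open>b\<close> reappear in the first row in swapped order, as form (4) requires.\<close>

lemma normal_form_product_nonzero:
  fixes N :: "'i \<Rightarrow> 'k::field ^ 4 ^ 4"
  assumes comm: "\<And>i j x. i \<in> S \<Longrightarrow> j \<in> S \<Longrightarrow> N i *v (N j *v x) = N j *v (N i *v x)"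
    and sq: "\<And>i x. i \<in> S \<Longrightarrow> N i *v (N i *v x) = 0"
    and mn: "m \<in> S" "n \<in> S" "N m *v (N n *v v) \<noteq> 0"
  obtains P where "invertible P" "simultaneous_form S (\<lambda>i. matrix_inv P ** (mat 1 + N i) ** P)"
proof -
  define a b c where "a = N m *v (N n *v v)" and "b = N m *v v" and "c = N n *v v"
  note lin = matrix_vector_right_distrib vec.scale
  have a0: "a \<noteq> 0" using mn by (simp add: a_def)
  have m: "N m *v v = b" "N m *v b = 0" "N m *v c = a" "N m *v a = 0"
    using mn sq by (simp_all add: a_def b_def c_def)
  have n: "N n *v v = c" "N n *v b = a" "N n *v c = 0" "N n *v a = 0"
    using mn sq comm[of n m] by (simp_all add: a_def b_def c_def)
  have inv: "invertible (cols4 a b c v)"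
  proof (rule invertible_cols4_independent)
    fix w x y z assume eq: "w *s a + x *s b + y *s c + z *s v = 0"
    \<comment> \<open>The product of \<open>N m\<close> and \<open>N n\<close> kills
      \<open>a\<close>, \<open>b\<close>, \<open>c\<close> and isolates the coefficient of
      \<open>v\<close>. After that \<open>N m\<close> alone isolates \<open>y\<close>, and
      \<open>N n\<close> alone isolates \<open>x\<close>.\<close>
    have "N m *v (N n *v (w *s a + x *s b + y *s c + z *s v)) = z *s a"
      by (simp add: lin m n)
    then have z: "z = 0" using eq a0 by simp
    have "N m *v (w *s a + x *s b + y *s c + z *s v) = y *s a" by (simp add: lin m z)
    then have y: "y = 0" using eq a0 by simp
    have "N n *v (w *s a + x *s b + y *s c + z *s v) = x *s a" by (simp add: lin n z y)
    then have x: "x = 0" using eq a0 by simp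
    show "w = 0 \<and> x = 0 \<and> y = 0 \<and> z = 0" using eq a0 x y z by simp
  qed
  have "\<exists>x y w. N i *v v = w *s a + y *s b + x *s c" if i: "i \<in> S" for i
  proof -
    obtain w y x z where eq: "N i *v v = w *s a + y *s b + x *s c + z *s v"
      using invertible_cols4_expand[OF inv] by metis
    \<comment> \<open>There is no \<open>v\<close> component: \<open>a\<close> is an eigenvector of
      \<open>N i\<close> with eigenvalue \<open>z\<close>, and \<open>N i\<close> squares to zero,
      so \<open>z * z = 0\<close>.\<close>
    have "N i *v a = N m *v (N n *v (N i *v v))"
      using comm i mn by (simp add: a_def)
    then have Na: "N i *v a = z *s a"
      by (simp add: eq lin m n)
    have "(z * z) *s a = N i *v (N i *v a)"
      by (simp add: Na lin)
    then have "z = 0" using sq[OF i] a0 by simp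
    then show ?thesis using eq by auto
  qed
  then obtain f g h where Nv: "\<And>i. i \<in> S \<Longrightarrow> N i *v v = h i *s a + g i *s b + f i *s c"
    by metis
  have Nb: "N i *v b = f i *s a" if "i \<in> S" for i
  proof -
    have "N i *v b = N m *v (N i *v v)" using comm that mn by (simp add: b_def)
    then show ?thesis by (simp add: Nv that lin m)
  qed
  have Nc: "N i *v c = g i *s a" if "i \<in> S" for i
  proof -
    have "N i *v c = N n *v (N i *v v)" using comm that mn by (simp add: c_def)
    then show ?thesis by (simp add: Nv that lin n)
  qed
  have Na: "N i *v a = 0" if "i \<in> S" for i
  proof -
    have "N i *v a = N m *v (N i *v c)" using comm that mn by (simp add: a_def c_def)
    then show ?thesis by (simp add: Nc that lin m)
  qed
  have "matrix_inv (cols4 a b c v) ** (mat 1 + N i) ** cols4 a b c v = form4 1 (f i) (g i) (h i)"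
    if "i \<in> S" for i
    using that by (intro conj_form4[OF inv]) (simp_all add: matrix_vector_mult_add_rdistrib Na Nb Nc Nv)
  then show thesis by (rule that[OF inv simultaneous_form4[OF one_neq_zero]])
qed

section \<open>From the representation to commuting matrices of square zero\<close>

text \<open>Expanding the square gives \<open>A ** A - 2 A + 1 = 2 - 2 A\<close>, which vanishes
  because 2 is zero in \<open>k\<close>.\<close>

lemma char_2_unipotent_part:
  fixes A :: "'k::field ^ 'n ^ 'n"
  assumes "A ** A = mat 1" "CHAR('k) = 2"
  shows "(A - mat 1) *v ((A - mat 1) *v x) = 0"
proof -
  have "(2 :: 'k) = 0" using of_nat_CHAR[where 'a = 'k] assms(2) by simp
  then have double: "y + y = 0" for y :: "'k ^ 'n"
    by (simp add: vec_eq_iff flip: mult_2)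
  have "(A - mat 1) *v ((A - mat 1) *v x) = (A ** A) *v x - A *v x - (A *v x - x)"
    by (simp add: matrix_vector_mult_diff_rdistrib matrix_vector_mult_diff_distrib
        flip: matrix_vector_mul_assoc)
  also have "\<dots> = (x + x) - (A *v x + A *v x)"
    by (simp add: assms(1))
  finally show ?thesis by (simp add: double)
qed

text \<open>Multiplicativity follows by inserting \<open>P ** matrix_inv P = mat 1\<close> between
  the two factors.\<close>

lemma is_representation_conj:
  fixes P :: "'k::field ^ 'n ^ 'n"
  assumes "is_representation G \<rho>" "invertible P"
  shows "is_representation G (\<lambda>g. matrix_inv P ** \<rho> g ** P)"
proof -
  have "matrix_inv P ** (X ** Y) ** P = (matrix_inv P ** X ** P) ** (matrix_inv P ** Y ** P)" for X Y
    using matrix_mult_inv_right[OF assms(2)] by (metis matrix_mul_assoc matrix_mul_lid)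
  moreover have "invertible (matrix_inv P)"
    using assms(2) by (metis invertible_def matrix_inv_cancel)
  ultimately show ?thesis
    using assms by (auto simp: is_representation_def hom_def GL_group_def Pi_def intro!: invertible_mult)
qed

theorem theorem5p8:
  fixes r :: nat and \<rho> :: "(nat \<Rightarrow> int) \<Rightarrow> 'k::field ^ 4 ^ 4"
  assumes "CHAR('k) = 2"
    and "r \<ge> 1"
    and "is_representation (elem_ab_group 2 r) \<rho>"
  shows "\<exists>\<rho>' :: (nat \<Rightarrow> int) \<Rightarrow> 'k ^ 4 ^ 4.
    is_representation (elem_ab_group 2 r) \<rho>' \<and>
    equivalent_representations (elem_ab_group 2 r) \<rho> \<rho>' \<and>
    ((\<exists>\<alpha> \<beta> \<gamma>. \<forall>i\<in>{1..r}. \<rho>' (std_gen r i) = form1 (\<alpha> i) (\<beta> i) (\<gamma> i)) \<or>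
     (\<exists>\<alpha> \<beta> \<gamma> \<delta>. \<forall>i\<in>{1..r}. \<rho>' (std_gen r i) = form2 (\<alpha> i) (\<beta> i) (\<gamma> i) (\<delta> i)) \<or>
     (\<exists>\<alpha> \<beta> \<gamma>. \<forall>i\<in>{1..r}. \<rho>' (std_gen r i) = form3 (\<alpha> i) (\<beta> i) (\<gamma> i)) \<or>
     (\<exists>\<mu> \<alpha> \<beta> \<gamma>. \<mu> \<noteq> 0 \<and> (\<forall>i\<in>{1..r}. \<rho>' (std_gen r i) = form4 \<mu> (\<alpha> i) (\<beta> i) (\<gamma> i))))"
proof -
  define G where "G = elem_ab_group 2 r"
  define e where "e = std_gen r"
  define N where "N = (\<lambda>i. \<rho> (e i) - mat 1)"
  have rep: "is_representation G \<rho>" using assms(3) by (simp add: G_def)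
  have hom: "\<rho> \<in> hom G GL_group" using rep by (simp add: is_representation_def)
  then interpret group_hom G GL_group \<rho>
    by (simp add: group_hom_def group_hom_axioms_def group_GL_group G_def group_elem_ab_group)
  have carr: "e i \<in> carrier G" for i by (simp add: e_def G_def std_gen_in_carrier)
  have mult: "\<rho> (e i \<otimes>\<^bsub>G\<^esub> e j) = \<rho> (e i) ** \<rho> (e j)" for i j
    using hom_mult[OF carr carr] by (simp add: GL_group_def)
  have "e i \<otimes>\<^bsub>G\<^esub> e j = e j \<otimes>\<^bsub>G\<^esub> e i" for i j
    by (simp add: G_def elem_ab_group_def add.commute)
  then have comm: "\<rho> (e i) ** \<rho> (e j) = \<rho> (e j) ** \<rho> (e i)" for i j
    by (metis mult)
  \<comment> \<open>Each generator has order dividing 2, so its image is an involution or the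
    identity; this is what makes \<open>N i\<close> square to zero.\<close>
  have "e i \<otimes>\<^bsub>G\<^esub> e i = \<one>\<^bsub>G\<^esub>" for i
    by (auto simp: G_def elem_ab_group_def e_def std_gen_def restrict_def)
  then have sq: "\<rho> (e i) ** \<rho> (e i) = mat 1" for i
    using mult[of i i] hom_one by (simp add: GL_group_def)
  have Nsq: "N i *v (N i *v x) = 0" for i x
    unfolding N_def using sq assms(1) by (rule char_2_unipotent_part)
  have Ncomm: "N i *v (N j *v x) = N j *v (N i *v x)" for i j x
    using arg_cong[OF comm[of i j], of "\<lambda>A. A *v x"]
    by (simp add: N_def matrix_vector_mult_diff_rdistrib matrix_vector_mult_diff_distrib
        flip: matrix_vector_mul_assoc)
  have N: "mat 1 + N i = \<rho> (e i)" for i by (simp add: N_def)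
  obtain P where P: "invertible P"
    and form: "simultaneous_form {1..r} (\<lambda>i. matrix_inv P ** (mat 1 + N i) ** P)"
  \<comment> \<open>One \<open>P\<close> must serve all generators, so the case distinction concerns
    the whole family of products at once.\<close>
  proof (cases "\<forall>i\<in>{1..r}. \<forall>j\<in>{1..r}. \<forall>x. N i *v (N j *v x) = 0")
    case True
    then show thesis
      by (intro normal_form_products_zero[of "{1..r}" N, OF _ that]) simp_all
  next
    case False
    then obtain m n v where "m \<in> {1..r}" "n \<in> {1..r}" "N m *v (N n *v v) \<noteq> 0" by blast
    then show thesis
      by (rule normal_form_product_nonzero[OF Ncomm Nsq _ _ _ that])
  qed
  have "equivalent_representations G \<rho> (\<lambda>g. matrix_inv P ** \<rho> g ** P)"
    using P by (auto simp: equivalent_representations_def)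
  then show ?thesis
    using is_representation_conj[OF rep P] form[unfolded simultaneous_form_def N]
    unfolding G_def e_def by (intro exI[of _ "\<lambda>g. matrix_inv P ** \<rho> g ** P"] conjI)
qed

end
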